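(* Let $k\geq 1$ be an integer and let $G$ be the Tanner graph of a variable-regular LDPC code with column weight $\gamma$. Suppose $G$ has girth $g=2(2k+1)$. Then there is no $(a,b)$ elementary trapping set in $G$ with $\frac{b}{a}<1$ of size $a\leq(\gamma-2)^k$.
   Context: A Tanner graph is a finite simple bipartite graph with vertex classes $V$ (variable nodes) and $C$ (check nodes). The code is variable-regular with column weight $\gamma$ if every variable node has degree $\gamma$ in the Tanner graph. The girth is the length of a shortest cycle. For a nonempty subset $S\subseteq V$ with $|S|=a$, consider the subgraph of the Tanner graph induced by $S$ together with all check nodes adjacent to some element of $S$; if exactly $b$ of these check nodes have odd degree in this subgraph, it is called an $(a,b)$ trapping set of size $a$. It is an elementary trapping set (ETS) if every one of these check nodes has degree $1$ or $2$ in the subgraph (so $b$ is the number of degree-one check nodes). *)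

theory Defs
  imports "Graph_Theory.Digraph_Component" "HOL-Library.Extended_Nat" Complex_Main
begin

text \<open>
  Finite simple graphs are the \<^locale>\<open>graph\<close>s of Graph_Theory: finite, loop-free symmetric
  digraphs without parallel arcs. Every undirected edge is represented by two opposite arcs, so
  the degree of a vertex is its \<^const>\<open>out_degree\<close>.
\<close>

locale tanner_graph = graph G for G :: "('n, 'e) pre_digraph" (structure) +
  fixes V C :: "'n set"
  assumes verts_eq: "verts G = V \<union> C"
    and disjoint: "V \<inter> C = {}"
    and bipartite: "e \<in> arcs G \<Longrightarrow>
      (tail G e \<in> V \<and> head G e \<in> C) \<or> (tail G e \<in> C \<and> head G e \<in> V)"

definition variable_regular :: "('n, 'e) pre_digraph \<Rightarrow> 'n set \<Rightarrow> nat \<Rightarrow> bool" where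
  "variable_regular G V \<gamma> \<longleftrightarrow> (\<forall>v \<in> V. out_degree G v = \<gamma>)"

text \<open>
  In a symmetric digraph, going back and forth along one edge is a \<^const>\<open>pre_digraph.cycle\<close>
  of length 2; the bound on the length excludes these. The girth of a forest is \<open>\<infinity>\<close>.
\<close>

definition girth :: "('n, 'e) pre_digraph \<Rightarrow> enat" where
  "girth G = (INF p \<in> {p. pre_digraph.cycle G p \<and> length p \<ge> 3}. enat (length p))"

definition adjacent_checks :: "('n, 'e) pre_digraph \<Rightarrow> 'n set \<Rightarrow> 'n set \<Rightarrow> 'n set" where
  "adjacent_checks G C S = {c \<in> C. \<exists>v \<in> S. v \<rightarrow>\<^bsub>G\<^esub> c}"

definition trapping_subgraph ::
  "('n, 'e) pre_digraph \<Rightarrow> 'n set \<Rightarrow> 'n set \<Rightarrow> ('n, 'e) pre_digraph" where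
  "trapping_subgraph G C S = G \<restriction> (S \<union> adjacent_checks G C S)"

definition trapping_set ::
  "('n, 'e) pre_digraph \<Rightarrow> 'n set \<Rightarrow> 'n set \<Rightarrow> nat \<Rightarrow> nat \<Rightarrow> 'n set \<Rightarrow> bool" where
  "trapping_set G V C a b S \<longleftrightarrow>
    S \<subseteq> V \<and> S \<noteq> {} \<and> card S = a \<and>
    card {c \<in> adjacent_checks G C S. odd (out_degree (trapping_subgraph G C S) c)} = b"

definition elementary_trapping_set ::
  "('n, 'e) pre_digraph \<Rightarrow> 'n set \<Rightarrow> 'n set \<Rightarrow> nat \<Rightarrow> nat \<Rightarrow> 'n set \<Rightarrow> bool" where
  "elementary_trapping_set G V C a b S \<longleftrightarrow>
    trapping_set G V C a b S \<and>
    (\<forall>c \<in> adjacent_checks G C S. out_degree (trapping_subgraph G C S) c \<in> {1, 2})"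

end

theory Submission
  imports Defs "HOL-Analysis.Convex"
begin

text \<open>
  In an elementary trapping set \<open>S\<close>, join two variables of \<open>S\<close> by an edge if they share a check.
  The girth of the resulting graph \<open>H\<close> is at least \<open>2 k + 1\<close>, and since \<open>b < a\<close> its average
  degree exceeds \<open>c = \<gamma> - 1\<close>. The bound \<open>a > (c - 1)\<^sup>k\<close> is the irregular Moore bound of Alon,
  Hoory and Linial. Assume first that all degrees \<open>d v\<close> of \<open>H\<close> are at least 2, and let
  \<open>N\<^sub>j (u, v)\<close> be the number of ends of non-backtracking walks that leave the arc \<open>(u, v)\<close> and make
  \<open>j\<close> further steps. By the girth condition different walks with \<open>j \<le> k\<close> have different ends, so
  \<open>N\<^sub>j\<^sub>+\<^sub>1 (u, v)\<close> is the sum of \<open>N\<^sub>j (v, w)\<close> over the \<open>d v - 1\<close> neighbours \<open>w \<noteq> u\<close> of \<open>v\<close>. As \<open>ln\<close> is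
  concave and every arc \<open>(v, w)\<close> continues exactly \<open>d v - 1\<close> arcs, the sum of \<open>ln N\<^sub>j\<close> over all arcs
  grows by at least \<open>\<Sum>\<^sub>v d v * ln (d v - 1)\<close> in each step, and \<open>x * ln (x - 1)\<close> is convex, so
  that some \<open>N\<^sub>k (u, v)\<close> exceeds \<open>(c - 1)\<^sup>k\<close>. Vertices of degree at most 1 can be deleted
  without lowering the average degree below \<open>c \<ge> 2\<close>.
\<close>

section \<open>Non-backtracking walks as vertex lists\<close>

fun nb_walk :: "('a \<Rightarrow> 'a \<Rightarrow> bool) \<Rightarrow> 'a list \<Rightarrow> bool" where
  "nb_walk R (x # y # zs) \<longleftrightarrow> R x y \<and> (zs \<noteq> [] \<longrightarrow> x \<noteq> hd zs) \<and> nb_walk R (y # zs)"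
| "nb_walk R _ \<longleftrightarrow> True"

text \<open>The two walks overlap in the vertex \<open>v\<close>, so the only turn that neither of
  them controls is the one from \<open>x\<close> through \<open>v\<close> to
  \<open>y\<close>.\<close>

lemma nb_walk_append:
  assumes "nb_walk R (xs @ [x, v])" "nb_walk R (v # y # ys)" "x \<noteq> y"
  shows "nb_walk R (xs @ x # v # y # ys)"
  using assms
proof (induction xs)
  case (Cons a xs)
  then show ?case by (cases xs rule: remdups_adj.cases) auto
qed auto

lemma nb_walk_prefix: "nb_walk R (xs @ ys) \<Longrightarrow> nb_walk R xs"
proof (induction R xs rule: nb_walk.induct)
  case (1 R x y zs)
  then show ?case by (cases zs) auto
qed auto

lemma nb_walk_rev:
  assumes "symp R" "nb_walk R xs"
  shows "nb_walk R (rev xs)"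
  using assms(2)
proof (induction xs rule: induct_list012)
  case (3 x y zs)
  show ?case
  proof (cases zs)
    case Nil
    then show ?thesis using 3 assms(1) by (auto dest: sympD)
  next
    case (Cons z zs')
    then show ?thesis
      using 3 assms(1) nb_walk_append[of R "rev zs'" z y x "[]"] by (auto dest: sympD)
  qed
qed auto

text \<open>The shortest suffix with a repetition starts with a vertex that recurs; cutting it there
  leaves a closed walk without other repetitions. Irreflexivity excludes \<open>[x, x]\<close> and
  non-backtracking excludes \<open>[x, a, x]\<close>, hence the 4 entries.\<close>

lemma nb_walk_not_distinct_imp_cycle:
  assumes "nb_walk R xs" "irreflp R" "\<not> distinct xs"
  obtains ys where "nb_walk R ys" "hd ys = last ys" "distinct (tl ys)"
    "4 \<le> length ys" "length ys \<le> length xs"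
proof -
  have "\<exists>ys. nb_walk R ys \<and> hd ys = last ys \<and> distinct (tl ys) \<and>
      4 \<le> length ys \<and> length ys \<le> length xs"
    using assms(1,3)
  proof (induction xs)
    case (Cons x xs)
    show ?case
    proof (cases "distinct xs")
      case False
      have "nb_walk R xs"
        using Cons.prems(1) by (cases xs) auto
      with Cons.IH False show ?thesis by fastforce
    next
      case True
      with Cons.prems(2) have "x \<in> set xs" by simp
      then obtain as bs where xs: "xs = as @ x # bs"
        by (auto simp: in_set_conv_decomp)
      have nb: "nb_walk R (x # as @ [x])"
        using Cons.prems(1) nb_walk_prefix[of R "x # as @ [x]" bs] by (simp add: xs)
      moreover have "as \<noteq> []"
        using nb assms(2) by (auto dest: irreflpD)
      moreover have "length as \<noteq> 1"
        using nb by (auto simp: length_Suc_conv)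
      ultimately have "4 \<le> length (x # as @ [x])"
        by (cases as rule: remdups_adj.cases) auto
      moreover have "distinct (as @ [x])" using True by (simp add: xs)
      ultimately show ?thesis using nb by (intro exI[of _ "x # as @ [x]"]) (auto simp: xs)
    qed
  qed simp
  then show ?thesis using that by blast
qed

text \<open>
  The last vertices of non-backtracking walks of \<open>j\<close> steps that start at \<open>v\<close> as if \<open>v\<close> had just
  been entered from \<open>u\<close>.
\<close>

fun walk_ends :: "('a \<Rightarrow> 'a \<Rightarrow> bool) \<Rightarrow> nat \<Rightarrow> 'a \<Rightarrow> 'a \<Rightarrow> 'a set" where
  "walk_ends R 0 u v = {v}"
| "walk_ends R (Suc j) u v = (\<Union>w \<in> {w. R v w} - {u}. walk_ends R j v w)"

lemma walk_ends_nb_walk: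
  assumes "y \<in> walk_ends R j u v" "R u v"
  obtains xs where "length xs = j" "nb_walk R (u # v # xs)" "last (v # xs) = y"
proof -
  have "\<exists>xs. length xs = j \<and> nb_walk R (u # v # xs) \<and> last (v # xs) = y"
    using assms
  proof (induction j arbitrary: u v)
    case (Suc j)
    then obtain w where w: "R v w" "w \<noteq> u" "y \<in> walk_ends R j v w" by auto
    from Suc.IH[OF w(3,1)] obtain xs
      where "length xs = j" "nb_walk R (v # w # xs)" "last (w # xs) = y" by blast
    then show ?case using w Suc.prems by (intro exI[of _ "w # xs"]) auto
  qed auto
  then show ?thesis using that by blast
qed

section \<open>Convexity estimates for logarithms\<close>

lemma ln_sum_ge_mean_ln:
  fixes x :: "'a \<Rightarrow> real"
  assumes "finite I" "I \<noteq> {}" "\<And>i. i \<in> I \<Longrightarrow> x i > 0"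
  shows "ln (real (card I)) + (\<Sum>i\<in>I. ln (x i)) / real (card I) \<le> ln (\<Sum>i\<in>I. x i)"
proof -
  define s where "s = (\<Sum>i\<in>I. x i)"
  define n where "n = real (card I)"
  have n: "n > 0" using assms by (simp add: n_def card_gt_0_iff)
  have s: "s > 0" unfolding s_def using assms by (intro sum_pos) auto
  \<comment> \<open>Jensen's inequality: \<open>ln\<close> lies below its tangent at the mean
    \<open>s / n\<close>, and the linear terms cancel in the sum.\<close>
  have "(\<Sum>i\<in>I. ln (x i)) \<le> (\<Sum>i\<in>I. n * x i / s - 1 + ln (s / n))"
  proof (rule sum_mono)
    fix i assume "i \<in> I"
    then have x: "x i > 0" using assms by auto
    have "ln (n * x i / s) \<le> n * x i / s - 1"
      using x n s by (intro ln_le_minus_one) auto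
    moreover have "ln (n * x i / s) = ln (x i) - ln (s / n)"
      using x n s by (simp add: ln_mult ln_div)
    ultimately show "ln (x i) \<le> n * x i / s - 1 + ln (s / n)" by linarith
  qed
  also have "\<dots> = n * (\<Sum>i\<in>I. x i) / s - n + n * ln (s / n)"
    by (simp add: sum.distrib sum_subtractf sum_distrib_left sum_divide_distrib n_def)
  also have "\<dots> = n * ln (s / n)" using s by (simp add: s_def[symmetric])
  finally have "(\<Sum>i\<in>I. ln (x i)) / n \<le> ln (s / n)"
    using n by (simp add: field_simps)
  then show ?thesis using n s by (simp add: ln_div n_def s_def)
qed

text \<open>The right-hand side is the tangent at \<open>c\<close> of \<open>x * ln (x - 1)\<close>,
  arranged so that its last term becomes positive when summed over degrees of average above
  \<open>c\<close>.\<close>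

lemma times_ln_above_tangent:
  fixes c x :: real
  assumes "c \<ge> 2" "x \<ge> 2"
  shows "x * ln (x - 1) \<ge> x * ln (c - 1) + c / (c - 1) * (x - c)"
proof -
  have "(ln (c - 1) + c / (c - 1)) * (x - c) \<le> x * ln (x - 1) - c * ln (c - 1)"
  proof (rule f''_imp_f'[where C = "{2..}"])
    fix t :: real assume t: "t \<in> {2..}"
    then show "((\<lambda>x. x * ln (x - 1)) has_real_derivative ln (t - 1) + t / (t - 1)) (at t)"
      by (auto intro!: derivative_eq_intros simp: field_simps)
    show "((\<lambda>x. ln (x - 1) + x / (x - 1)) has_real_derivative
        1 / (t - 1) + ((t - 1) - t) / ((t - 1) * (t - 1))) (at t)"
      using t by (auto intro!: derivative_eq_intros)
    \<comment> \<open>The second derivative is \<open>1 / (t - 1) - 1 / (t - 1)^2\<close>,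
      nonnegative because \<open>t - 1 >= 1\<close>.\<close>
    have "((t - 1) - t) / ((t - 1) * (t - 1)) \<ge> - (1 / (t - 1))"
      using t by (simp add: divide_simps)
    then show "0 \<le> 1 / (t - 1) + ((t - 1) - t) / ((t - 1) * (t - 1))" by linarith
  qed (use assms in auto)
  then show ?thesis by (simp add: algebra_simps)
qed

section \<open>The Moore bound for minimum degree two\<close>

context
  fixes R :: "'a \<Rightarrow> 'a \<Rightarrow> bool" and W :: "'a set" and k :: nat
  assumes finW: "finite W"
    and RW: "\<And>u v. R u v \<Longrightarrow> u \<in> W \<and> v \<in> W"
    and symR: "symp R"
    and nb_walk_open: "\<And>xs. nb_walk R xs \<Longrightarrow> 2 \<le> length xs \<Longrightarrow> length xs \<le> 2 * k + 1 \<Longrightarrow>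
      hd xs \<noteq> last xs"
begin

lemma finite_nbhd: "finite {w. R v w}"
  by (rule finite_subset[OF _ finW]) (use RW in blast)

lemma walk_ends_subset: "R u v \<Longrightarrow> walk_ends R j u v \<subseteq> W"
  by (induction j arbitrary: u v) (use RW in fastforce)+

lemma walk_ends_disjoint:
  assumes "j < k" "R v w" "R v w'" "w \<noteq> w'"
  shows "walk_ends R j v w \<inter> walk_ends R j v w' = {}"
proof (rule ccontr)
  assume "\<not> ?thesis"
  then obtain y where y: "y \<in> walk_ends R j v w" "y \<in> walk_ends R j v w'" by blast
  from y(1) assms(2) obtain xs
    where xs: "length xs = j" "nb_walk R (v # w # xs)" "last (w # xs) = y"
    by (rule walk_ends_nb_walk)
  from y(2) assms(3) obtain xs'
    where xs': "length xs' = j" "nb_walk R (v # w' # xs')" "last (w' # xs') = y"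
    by (rule walk_ends_nb_walk)
  txt \<open>Glued at \<open>v\<close>, the two walks form a closed walk at \<open>y\<close> that does not backtrack at \<open>v\<close>.\<close>
  have "nb_walk R (rev xs @ w # v # w' # xs')"
    using nb_walk_rev[OF symR xs(2)] xs'(2) assms(4) by (intro nb_walk_append) auto
  moreover have "hd (rev xs @ w # v # w' # xs') = y"
    using xs(3) by (cases xs) (auto simp: hd_append hd_rev)
  moreover have "last (rev xs @ w # v # w' # xs') = y"
    using xs'(3) by simp
  \<comment> \<open>The glued walk has \<open>2 * j + 3\<close> vertices, at most
    \<open>2 * k + 1\<close> since \<open>j < k\<close>. It may backtrack at \<open>y\<close>, where
    \<open>nb_walk\<close> imposes nothing.\<close>
  ultimately show False
    using nb_walk_open[of "rev xs @ w # v # w' # xs'"] xs(1) xs'(1) assms(1) by simp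
qed

lemma card_walk_ends_Suc:
  assumes "j < k" "R u v"
  shows "card (walk_ends R (Suc j) u v) = (\<Sum>w\<in>{w. R v w} - {u}. card (walk_ends R j v w))"
  unfolding walk_ends.simps
proof (rule card_UN_disjoint)
  show "\<forall>w\<in>{w. R v w} - {u}. finite (walk_ends R j v w)"
    using finite_subset[OF walk_ends_subset finW] by auto
qed (use walk_ends_disjoint assms finite_nbhd in auto)

text \<open>Regroups a sum over arcs by heads instead of tails; by symmetry the tails of the arcs
  into \<open>v\<close> are the neighbours of \<open>v\<close>.\<close>

lemma sum_arcs_swap:
  fixes f :: "'a \<Rightarrow> 'a \<Rightarrow> real"
  shows "(\<Sum>u\<in>W. \<Sum>v\<in>{v. R u v}. f u v) = (\<Sum>v\<in>W. \<Sum>u\<in>{u. R v u}. f u v)"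
proof -
  have "(\<Sum>u\<in>W. \<Sum>v\<in>{v. R u v}. f u v) = (\<Sum>u\<in>W. \<Sum>v\<in>{v. v \<in> W \<and> R u v}. f u v)"
    using RW by (intro sum.cong) auto
  also have "\<dots> = (\<Sum>v\<in>W. \<Sum>u\<in>{u. u \<in> W \<and> R u v}. f u v)"
    by (rule sum.swap_restrict[OF finW finW])
  also have "\<dots> = (\<Sum>v\<in>W. \<Sum>u\<in>{u. R v u}. f u v)"
    using RW symR by (intro sum.cong) (auto dest: sympD)
  finally show ?thesis .
qed

context
  assumes deg2: "\<And>v. v \<in> W \<Longrightarrow> 2 \<le> card {w. R v w}"
begin

lemma card_walk_ends_pos:
  assumes "j \<le> k" "R u v"
  shows "0 < card (walk_ends R j u v)"
  using assms
proof (induction j arbitrary: u v)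
  case (Suc j)
  have "v \<in> W" using Suc.prems RW by blast
  then have "card ({w. R v w} - {u}) \<noteq> 0"
    using deg2[of v] by (simp add: card_Diff_singleton_if split: if_splits)
  then obtain w where "w \<in> {w. R v w} - {u}"
    by (metis card.empty ex_in_conv)
  then show ?case
    using Suc.IH[of v w] Suc.prems finite_nbhd
    by (subst card_walk_ends_Suc) (auto intro!: sum_pos2)
qed auto

text \<open>Jensen's inequality applied to the recursion \<open>card_walk_ends_Suc\<close>. Since
  \<open>u\<close> is itself a neighbour of \<open>v\<close>, the sum has one term fewer than the
  degree of \<open>v\<close>.\<close>

lemma ln_card_walk_ends_Suc_ge:
  assumes "j < k" "R u v"
  shows "ln (real (card {w. R v w}) - 1) +
      (\<Sum>w\<in>{w. R v w} - {u}. ln (real (card (walk_ends R j v w)))) / (real (card {w. R v w}) - 1)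
    \<le> ln (real (card (walk_ends R (Suc j) u v)))"
proof -
  have v: "v \<in> W" "R v u" using assms RW symR by (auto dest: sympD)
  then have card: "real (card ({w. R v w} - {u})) = real (card {w. R v w}) - 1"
    using deg2[of v] by (simp add: card_Diff_singleton_if of_nat_diff)
  moreover have "{w. R v w} - {u} \<noteq> {}"
    using card deg2[OF v(1)] by (intro notI) simp
  ultimately show ?thesis
    using ln_sum_ge_mean_ln[of "{w. R v w} - {u}" "\<lambda>w. real (card (walk_ends R j v w))"]
      finite_nbhd card_walk_ends_pos assms
    by (simp add: card_walk_ends_Suc[OF assms] del: walk_ends.simps)
qed

lemma sum_ln_card_walk_ends_ge:
  assumes "j \<le> k"
  shows "real j * (\<Sum>v\<in>W. real (card {w. R v w}) * ln (real (card {w. R v w}) - 1))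
    \<le> (\<Sum>u\<in>W. \<Sum>v\<in>{v. R u v}. ln (real (card (walk_ends R j u v))))"
  using assms
proof (induction j)
  case (Suc j)
  define d where "d v = real (card {w. R v w})" for v
  define l where "l u v = ln (real (card (walk_ends R j u v)))" for u v
  have *: "(\<Sum>u\<in>{u. R v u}. ln (d v - 1) + (\<Sum>w\<in>{w. R v w} - {u}. l v w) / (d v - 1))
      = d v * ln (d v - 1) + (\<Sum>w\<in>{w. R v w}. l v w)" if "v \<in> W" for v
  proof -
    have dv: "d v \<ge> 2" using deg2[OF that] by (simp add: d_def)
    \<comment> \<open>Each \<open>l v w\<close> occurs once for every neighbour \<open>u\<close> of
      \<open>v\<close> other than \<open>w\<close>, so \<open>d v - 1\<close> times; this cancels
      the division.\<close>
    have "(\<Sum>u\<in>{u. R v u}. \<Sum>w\<in>{w. R v w} - {u}. l v w)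
        = (\<Sum>u\<in>{u. R v u}. (\<Sum>w\<in>{w. R v w}. l v w) - l v u)"
      by (intro sum.cong refl) (simp add: sum_diff1 finite_nbhd)
    also have "\<dots> = (d v - 1) * (\<Sum>w\<in>{w. R v w}. l v w)"
      by (simp add: sum_subtractf d_def algebra_simps)
    finally show ?thesis
      using dv by (simp add: sum.distrib sum_divide_distrib[symmetric] d_def)
  qed
  have "real (Suc j) * (\<Sum>v\<in>W. d v * ln (d v - 1))
      \<le> (\<Sum>v\<in>W. d v * ln (d v - 1)) + (\<Sum>v\<in>W. \<Sum>w\<in>{w. R v w}. l v w)"
    using Suc by (simp add: d_def l_def algebra_simps)
  also have "\<dots> = (\<Sum>v\<in>W. \<Sum>u\<in>{u. R v u}.
      ln (d v - 1) + (\<Sum>w\<in>{w. R v w} - {u}. l v w) / (d v - 1))"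
    using * by (simp add: sum.distrib)
  also have "\<dots> = (\<Sum>u\<in>W. \<Sum>v\<in>{v. R u v}.
      ln (d v - 1) + (\<Sum>w\<in>{w. R v w} - {u}. l v w) / (d v - 1))"
    by (rule sum_arcs_swap[symmetric])
  also have "\<dots> \<le> (\<Sum>u\<in>W. \<Sum>v\<in>{v. R u v}. ln (real (card (walk_ends R (Suc j) u v))))"
    unfolding d_def l_def using Suc.prems
    by (intro sum_mono ln_card_walk_ends_Suc_ge) auto
  finally show ?case by (simp add: d_def del: walk_ends.simps)
qed simp

lemma irregular_moore_bound_min_degree:
  fixes c :: real
  assumes "k \<ge> 1" "c \<ge> 2" "c * real (card W) < (\<Sum>v\<in>W. real (card {w. R v w}))"
  shows "(c - 1) ^ k < real (card W)"
proof (rule ccontr)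
  assume *: "\<not> ?thesis"
  define d where "d v = real (card {w. R v w})" for v
  have "W \<noteq> {}" using assms by auto
  then have n: "real (card W) \<ge> 1" using finW by (simp add: Suc_le_eq card_gt_0_iff)
  \<comment> \<open>The added term is positive because the average degree exceeds \<open>c\<close>;
    it is the summed linear part of the tangent at \<open>c\<close>.\<close>
  have "(\<Sum>v\<in>W. d v) * ln (c - 1) < (\<Sum>v\<in>W. d v) * ln (c - 1) + c / (c - 1) * ((\<Sum>v\<in>W. d v) - c * card W)"
    using assms by (simp add: d_def)
  also have "\<dots> = (\<Sum>v\<in>W. d v * ln (c - 1) + c / (c - 1) * (d v - c))"
    by (simp add: sum.distrib sum_subtractf del: times_divide_eq_left
        flip: sum_distrib_left sum_distrib_right)
  also have "\<dots> \<le> (\<Sum>v\<in>W. d v * ln (d v - 1))"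
    using assms deg2 by (intro sum_mono times_ln_above_tangent) (auto simp: d_def)
  finally have "real k * ((\<Sum>v\<in>W. d v) * ln (c - 1)) < real k * (\<Sum>v\<in>W. d v * ln (d v - 1))"
    using assms by simp
  also have "\<dots> \<le> (\<Sum>u\<in>W. \<Sum>v\<in>{v. R u v}. ln (real (card (walk_ends R k u v))))"
    using sum_ln_card_walk_ends_ge[of k] by (simp add: d_def)
  \<comment> \<open>All walk ends lie in \<open>W\<close>, which has at most
    \<open>(c - 1) ^ k\<close> elements by the negated goal.\<close>
  also have "\<dots> \<le> (\<Sum>u\<in>W. \<Sum>v\<in>{v. R u v}. real k * ln (c - 1))"
  proof (intro sum_mono)
    fix u v assume "v \<in> {v. R u v}"
    then have "0 < card (walk_ends R k u v)" "card (walk_ends R k u v) \<le> card W"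
      using card_walk_ends_pos card_mono[OF finW walk_ends_subset] by auto
    then have "ln (real (card (walk_ends R k u v))) \<le> ln ((c - 1) ^ k)"
      using * by (subst ln_le_cancel_iff) (use assms in auto)
    then show "ln (real (card (walk_ends R k u v))) \<le> real k * ln (c - 1)"
      using assms by (simp add: ln_realpow)
  qed
  also have "\<dots> = real k * ((\<Sum>v\<in>W. d v) * ln (c - 1))"
    by (simp add: d_def sum_distrib_left sum_distrib_right algebra_simps)
  finally show False by simp
qed

end

end

section \<open>Removing the minimum degree condition\<close>

lemma nb_walk_mono: "nb_walk R xs \<Longrightarrow> (\<And>x y. R x y \<Longrightarrow> S x y) \<Longrightarrow> nb_walk S xs"
  by (induction R xs rule: nb_walk.induct) auto

text \<open>Deleting a vertex of degree at most 1 lowers the degree sum by at most 2 and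
  \<open>c * card W\<close> by \<open>c >= 2\<close>, so the strict inequality survives.
  \<open>R\<close> stays fixed and only \<open>W\<close> shrinks, so the walk hypothesis carries
  over.\<close>

lemma irregular_moore_bound:
  fixes R :: "'a \<Rightarrow> 'a \<Rightarrow> bool" and c :: real
  assumes "finite W" "symp R" "k \<ge> 1" "c \<ge> 2"
    and nb_walk_open: "\<And>xs. nb_walk R xs \<Longrightarrow> 2 \<le> length xs \<Longrightarrow> length xs \<le> 2 * k + 1 \<Longrightarrow>
      hd xs \<noteq> last xs"
    and avg: "c * real (card W) < (\<Sum>v\<in>W. real (card {w \<in> W. R v w}))"
  shows "(c - 1) ^ k < real (card W)"
  using assms(1) avg
proof (induction "card W" arbitrary: W rule: less_induct)
  case less
  show ?case
  proof (cases "\<forall>v\<in>W. 2 \<le> card {w \<in> W. R v w}")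
    case True
    let ?R = "\<lambda>u v. u \<in> W \<and> v \<in> W \<and> R u v"
    show ?thesis
    proof (rule irregular_moore_bound_min_degree[of W ?R])
      show "hd xs \<noteq> last xs"
        if "nb_walk ?R xs" "2 \<le> length xs" "length xs \<le> 2 * k + 1" for xs
        using nb_walk_open[OF nb_walk_mono[OF that(1)]] that(2,3) by blast
      show "c * real (card W) < (\<Sum>v\<in>W. real (card {w. ?R v w}))"
        using less.prems(2) by simp
      show "2 \<le> card {w. ?R v w}" if "v \<in> W" for v
        using True that by simp
      show "symp ?R" using assms(2) by (auto simp: symp_def)
    qed (use less.prems assms in auto)
  next
    case False
    then obtain x where x: "x \<in> W" "card {w \<in> W. R x w} \<le> 1" by force
    define W' where "W' = W - {x}"
    have W': "finite W'" "W = insert x W'" "x \<notin> W'" using x less.prems by (auto simp: W'_def)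
    have "(\<Sum>v\<in>W'. real (card {w \<in> W. R v w}))
        \<le> (\<Sum>v\<in>W'. real (card {w \<in> W'. R v w}) + (if R v x then 1 else 0))"
    proof (rule sum_mono)
      fix v
      have "{w \<in> W. R v w} = {w \<in> W'. R v w} \<union> (if R v x then {x} else {})"
        using W' by auto
      then show "real (card {w \<in> W. R v w}) \<le> real (card {w \<in> W'. R v w}) + (if R v x then 1 else 0)"
        using card_Un_le[of "{w \<in> W'. R v w}" "if R v x then {x} else {}"] by auto
    qed
    also have "\<dots> = (\<Sum>v\<in>W'. real (card {w \<in> W'. R v w})) + real (card {v \<in> W'. R v x})"
      using W' by (simp add: sum.distrib Int_def flip: sum.inter_filter)
    also have "card {v \<in> W'. R v x} \<le> card {w \<in> W. R x w}"
      using W' assms(2) by (intro card_mono) (auto dest: sympD)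
    \<comment> \<open>One unit bounds the degree of \<open>x\<close> itself, the other what the
      remaining vertices lose.\<close>
    finally have "(\<Sum>v\<in>W. real (card {w \<in> W. R v w})) \<le> (\<Sum>v\<in>W'. real (card {w \<in> W'. R v w})) + 2"
      using W' x(2) by simp
    moreover have "real (card W) = real (card W') + 1" using W' by simp
    ultimately have "c * real (card W') < (\<Sum>v\<in>W'. real (card {w \<in> W'. R v w}))"
      using less.prems(2) assms(4) by (simp add: algebra_simps)
    then have "(c - 1) ^ k < real (card W')"
      using less.hyps[of W'] W' by simp
    then show ?thesis using W' by simp
  qed
qed

section \<open>From vertex lists to arcs, girth and degrees\<close>

lemma (in wf_digraph) nb_walk_imp_awalk:
  assumes "nb_walk (\<lambda>u v. u \<rightarrow> v) (u # xs)" "u \<in> verts G"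
  obtains p where "awalk u p (last (u # xs))" "awalk_verts u p = u # xs"
proof -
  have "\<exists>p. awalk u p (last (u # xs)) \<and> awalk_verts u p = u # xs"
    using assms
  proof (induction xs arbitrary: u)
    case Nil
    then show ?case by (intro exI[of _ "[]"]) (simp add: awalk_Nil_iff)
  next
    case (Cons v xs)
    then obtain e where e: "e \<in> arcs G" "tail G e = u" "head G e = v" by auto
    from Cons e obtain p where "awalk v p (last (v # xs))" "awalk_verts v p = v # xs"
      by fastforce
    then show ?case using e Cons.prems
      by (intro exI[of _ "e # p"]) (auto simp: awalk_Cons_iff)
  qed
  then show ?thesis using that by blast
qed

lemma (in graph) nb_walk_distinct:
  assumes "nb_walk (\<lambda>u v. u \<rightarrow> v) xs" "enat (length xs) \<le> girth G"
  shows "distinct xs"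
proof (rule ccontr)
  assume "\<not> distinct xs"
  moreover have "irreflp (\<lambda>u v. u \<rightarrow> v)"
    by (auto intro!: irreflpI dest: adj_not_same)
  ultimately obtain ys where ys: "nb_walk (\<lambda>u v. u \<rightarrow> v) ys" "hd ys = last ys" "distinct (tl ys)"
    "4 \<le> length ys" "length ys \<le> length xs"
    using assms(1) nb_walk_not_distinct_imp_cycle by metis
  then obtain u v zs where uv: "ys = u # v # zs"
    by (cases ys rule: remdups_adj.cases) auto
  then have "u \<in> verts G" using ys(1) by (auto dest: adj_in_verts)
  then obtain p where p: "awalk u p (last ys)" "awalk_verts u p = ys"
    using nb_walk_imp_awalk[of u "v # zs"] ys(1) uv by metis
  \<comment> \<open>There is one arc fewer than vertices: at least 3, as \<open>girth\<close>
    demands, and fewer than \<open>length xs\<close>.\<close>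
  have len: "Suc (length p) = length ys" using p(2) length_awalk_verts[of u p] by simp
  then have "cycle p"
    unfolding cycle_def using p ys uv by (intro exI[of _ u]) auto
  then have "girth G \<le> enat (length p)"
    unfolding girth_def using len ys(4) by (intro INF_lower) auto
  also have "\<dots> < enat (length xs)" using len ys(5) by simp
  finally show False using assms(2) by simp
qed

lemma (in nomulti_digraph) out_degree_induce_subgraph:
  assumes "u \<in> W"
  shows "out_degree (G \<restriction> W) u = card {v \<in> W. u \<rightarrow> v}"
proof -
  have "bij_betw (head G) (out_arcs (G \<restriction> W) u) {v \<in> W. u \<rightarrow> v}"
    unfolding bij_betw_def
  proof
    show "inj_on (head G) (out_arcs (G \<restriction> W) u)"
      by (rule inj_onI) (auto simp: arc_to_ends_def intro: no_multi_arcs)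
    show "head G ` out_arcs (G \<restriction> W) u = {v \<in> W. u \<rightarrow> v}"
      using assms by (auto simp: arcs_ends_conv image_iff)
  qed
  then show ?thesis unfolding out_degree_def by (rule bij_betw_same_card)
qed

section \<open>The graph \<open>H\<close> on the variables of a trapping set\<close>

definition sharing_neighbour :: "('a \<Rightarrow> 'a \<Rightarrow> bool) \<Rightarrow> 'a set \<Rightarrow> 'a \<Rightarrow> 'a \<Rightarrow> bool" where
  "sharing_neighbour A S u v \<longleftrightarrow> u \<in> S \<and> v \<in> S \<and> u \<noteq> v \<and> (\<exists>c. A u c \<and> A c v)"

text \<open>Insert a shared check between consecutive variables. Using one check on both sides of a
  variable would give that check three distinct neighbours in \<open>S\<close>, which
  \<open>deg\<close> forbids.\<close>

lemma nb_walk_subdivide: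
  assumes "symp A" "nb_walk (sharing_neighbour A S) (x # xs)"
    and deg: "\<And>u v w c. {u, v, w} \<subseteq> S \<Longrightarrow> distinct [u, v, w] \<Longrightarrow> A c u \<Longrightarrow> A c v \<Longrightarrow> A c w \<Longrightarrow> False"
  obtains ys where "nb_walk A (x # ys)" "length ys = 2 * length xs"
    "last (x # ys) = last (x # xs)"
proof -
  \<comment> \<open>The last conjunct exposes the first check and the next variable, so that the
    induction step can compare successive checks.\<close>
  have "\<exists>ys. nb_walk A (x # ys) \<and> length ys = 2 * length xs \<and> last (x # ys) = last (x # xs) \<and>
      (xs \<noteq> [] \<longrightarrow> (\<exists>c zs. ys = c # hd xs # zs))"
    using assms(2)
  proof (induction xs arbitrary: x)
    case (Cons y xs)
    then obtain c where c: "A x c" "A c y" "x \<in> S" "y \<in> S" "x \<noteq> y"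
      by (auto simp: sharing_neighbour_def)
    from Cons obtain ys where ys: "nb_walk A (y # ys)" "length ys = 2 * length xs"
      "last (y # ys) = last (y # xs)" "xs \<noteq> [] \<longrightarrow> (\<exists>c zs. ys = c # hd xs # zs)"
      by fastforce
    have "ys \<noteq> [] \<longrightarrow> c \<noteq> hd ys"
    proof
      assume "ys \<noteq> []"
      with ys(2) have "xs \<noteq> []" by auto
      with ys(4) obtain d z xs' zs where eq: "xs = z # xs'" "ys = d # z # zs"
        by (cases xs) auto
      then have "x \<noteq> z" "sharing_neighbour A S y z"
        using Cons.prems by auto
      moreover have "A d z" using ys(1) eq by simp
      ultimately show "c \<noteq> hd ys"
        using deg[of x y z c] c assms(1) eq by (auto simp: sharing_neighbour_def dest: sympD)
    qed
    then show ?case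
      using ys c by (intro exI[of _ "c # y # ys"]) auto
  qed simp
  then show ?thesis using that by blast
qed

text \<open>Of the checks at each variable, those of degree 1 number at most \<open>b\<close> over
  all of \<open>S\<close>, while those of degree 2 lead to distinct neighbours in
  \<open>H\<close>.\<close>

lemma (in tanner_graph) ets_variable_pairs:
  assumes "variable_regular G V \<gamma>" "elementary_trapping_set G V C a b S" "6 \<le> girth G"
  shows "a * \<gamma> \<le> b + (\<Sum>v\<in>S. card {w \<in> S. sharing_neighbour (\<lambda>u v. u \<rightarrow> v) S v w})"
    and "{u, v, w} \<subseteq> S \<Longrightarrow> distinct [u, v, w] \<Longrightarrow> c \<rightarrow> u \<Longrightarrow> c \<rightarrow> v \<Longrightarrow> \<not> c \<rightarrow> w"
proof -
  define deg where "deg c = card {v \<in> S. c \<rightarrow> v}" for c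
  define adj where "adj = adjacent_checks G C S"
  have S: "S \<subseteq> V" "card S = a"
    using assms(2) by (auto simp: elementary_trapping_set_def trapping_set_def)
  have finS: "finite S" using S(1) verts_eq finite_subset[OF _ finite_verts] by blast
  have sym: "u \<rightarrow> v \<longleftrightarrow> v \<rightarrow> u" for u v
    using sym_arcs by (auto dest: arcs_ends_symmetric)
  have bip: "u \<in> V \<longleftrightarrow> v \<in> C" "u \<in> C \<longleftrightarrow> v \<in> V" if "u \<rightarrow> v" for u v
    using that disjoint by (auto elim!: reachableE dest!: bipartite)
  have adjI: "c \<in> adj" if "v \<in> S" "v \<rightarrow> c" for c v
    using that bip(1)[OF that(2)] S(1) by (auto simp: adj_def adjacent_checks_def)
  have out_degree: "out_degree (trapping_subgraph G C S) c = deg c" if "c \<in> adj" for c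
  proof -
    have "c \<in> C" using that by (auto simp: adj_def adjacent_checks_def)
    then have "{v \<in> S \<union> adj. c \<rightarrow> v} = {v \<in> S. c \<rightarrow> v}"
      using bip disjoint by (auto simp: adj_def adjacent_checks_def)
    then show ?thesis
      using that unfolding trapping_subgraph_def deg_def adj_def
      by (subst out_degree_induce_subgraph) auto
  qed
  then have deg: "deg c \<in> {1, 2}" if "c \<in> adj" for c
    using that assms(2) by (auto simp: elementary_trapping_set_def adj_def)
  have b: "card {c \<in> adj. odd (deg c)} = b"
  proof -
    have "{c \<in> adj. odd (deg c)} =
        {c \<in> adjacent_checks G C S. odd (out_degree (trapping_subgraph G C S) c)}"
      using out_degree by (auto simp: adj_def)
    then show ?thesis
      using assms(2) by (simp add: elementary_trapping_set_def trapping_set_def)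
  qed
  have nbhd: "card {c. v \<rightarrow> c} = \<gamma>" if "v \<in> S" for v
  proof -
    have v: "v \<in> V" using that S by blast
    have "out_degree (G \<restriction> verts G) v = card {c \<in> verts G. v \<rightarrow> c}"
      using v verts_eq by (intro out_degree_induce_subgraph) auto
    moreover have "out_arcs (G \<restriction> verts G) v = out_arcs G v" by auto
    moreover have "{c \<in> verts G. v \<rightarrow> c} = {c. v \<rightarrow> c}" by (auto dest: adj_in_verts)
    ultimately show ?thesis
      using assms(1) v by (simp add: variable_regular_def out_degree_def)
  qed
  have finN: "finite {c. v \<rightarrow> c \<and> P c}" for v P
    by (rule finite_subset[OF _ finite_verts]) (auto dest: adj_in_verts)
  show "\<not> c \<rightarrow> w" if uvw: "{u, v, w} \<subseteq> S" "distinct [u, v, w]" "c \<rightarrow> u" "c \<rightarrow> v" for u v w c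
  proof
    assume "c \<rightarrow> w"
    then have "{u, v, w} \<subseteq> {v \<in> S. c \<rightarrow> v}" using uvw by auto
    then have "card {u, v, w} \<le> deg c"
      unfolding deg_def using finS by (intro card_mono) auto
    moreover have "c \<in> adj" using uvw sym adjI[of u c] by auto
    ultimately show False using deg[of c] uvw(2) by auto
  qed
  define Q where "Q v = {c. v \<rightarrow> c \<and> deg c = 1}" for v
  define P where "P v = {c. v \<rightarrow> c \<and> deg c = 2}" for v
  have "(\<Sum>v\<in>S. card (Q v)) = card (Sigma S Q)"
    using finS finN by (subst card_SigmaI) (auto simp: Q_def)
  \<comment> \<open>A check of degree 1 determines its variable in \<open>S\<close>, so projecting
    the pairs to their checks is injective.\<close>
  also have "\<dots> \<le> card {c \<in> adj. odd (deg c)}"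
  proof (rule card_inj_on_le[where f = snd])
    show "inj_on snd (Sigma S Q)"
    proof (rule inj_onI, clarsimp)
      fix v w c assume *: "v \<in> S" "w \<in> S" "c \<in> Q v" "c \<in> Q w"
      then obtain x where "{v \<in> S. c \<rightarrow> v} = {x}"
        by (auto simp: Q_def deg_def card_1_singleton_iff)
      moreover have "v \<in> {v \<in> S. c \<rightarrow> v}" "w \<in> {v \<in> S. c \<rightarrow> v}"
        using * sym by (auto simp: Q_def)
      ultimately show "v = w" by auto
    qed
    show "finite {c \<in> adj. odd (deg c)}"
      by (rule finite_subset[OF _ finite_verts])
        (auto simp: adj_def adjacent_checks_def dest: adj_in_verts)
  qed (auto simp: Q_def intro: adjI)
  finally have Q: "(\<Sum>v\<in>S. card (Q v)) \<le> b" using b by simp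
  have P: "card (P v) \<le> card {w \<in> S. sharing_neighbour (\<lambda>u v. u \<rightarrow> v) S v w}" if v: "v \<in> S" for v
  proof -
    have "\<exists>w. w \<in> S \<and> w \<noteq> v \<and> c \<rightarrow> w" if "c \<in> P v" for c
    proof (rule ccontr)
      assume "\<not> ?thesis"
      then have "{w \<in> S. c \<rightarrow> w} \<subseteq> {v}" by auto
      then have "deg c \<le> 1" unfolding deg_def using card_mono[of "{v}"] by auto
      then show False using that by (simp add: P_def)
    qed
    then obtain f where f: "\<And>c. c \<in> P v \<Longrightarrow> f c \<in> S \<and> f c \<noteq> v \<and> c \<rightarrow> f c"
      by metis
    txt \<open>\<open>f\<close> is injective because two checks with two common neighbours form a 4-cycle.\<close>
    show ?thesis
    proof (rule card_inj_on_le[where f = f])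
      show "inj_on f (P v)"
      proof (rule inj_onI, rule ccontr)
        fix c d assume *: "c \<in> P v" "d \<in> P v" "f c = f d" "c \<noteq> d"
        then have "nb_walk (\<lambda>u v. u \<rightarrow> v) [v, c, f c, d, v]"
          using f[of c] f[of d] sym by (auto simp: P_def)
        moreover have "enat (length [v, c, f c, d, v]) \<le> girth G"
          using order_trans[OF _ assms(3), of 5] by (simp add: numeral_eq_enat eval_nat_numeral)
        ultimately have "distinct [v, c, f c, d, v]" by (rule nb_walk_distinct)
        then show False by simp
      qed
    qed (use f v finS in \<open>auto simp: sharing_neighbour_def P_def\<close>)
  qed
  have "\<gamma> = card (P v) + card (Q v)" if "v \<in> S" for v
  proof -
    have "{c. v \<rightarrow> c} = P v \<union> Q v"
      using deg adjI[OF that] by (auto simp: P_def Q_def)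
    moreover have "card (P v \<union> Q v) = card (P v) + card (Q v)"
      by (rule card_Un_disjoint) (use finN in \<open>auto simp: P_def Q_def\<close>)
    ultimately show ?thesis using nbhd[OF that] by simp
  qed
  then have "(\<Sum>v\<in>S. \<gamma>) = (\<Sum>v\<in>S. card (P v) + card (Q v))"
    by (rule sum.cong[OF refl])
  then have "a * \<gamma> = (\<Sum>v\<in>S. card (P v) + card (Q v))"
    using S(2) by simp
  also have "\<dots> \<le> b + (\<Sum>v\<in>S. card {w \<in> S. sharing_neighbour (\<lambda>u v. u \<rightarrow> v) S v w})"
    using Q sum_mono[of S "\<lambda>v. card (P v)", OF P] by (simp add: sum.distrib)
  finally show "a * \<gamma> \<le> b + (\<Sum>v\<in>S. card {w \<in> S. sharing_neighbour (\<lambda>u v. u \<rightarrow> v) S v w})" .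
qed

text \<open>Column weight 0 leaves no arcs, so the infimum is over the empty set. For even
  \<open>k\<close> the size bound \<open>(-2) ^ k\<close> is positive, and the finite girth is what
  excludes this case.\<close>

lemma (in tanner_graph) girth_variable_regular_0:
  assumes "variable_regular G V 0"
  shows "girth G = \<infinity>"
proof -
  have no_out: "out_arcs G v = {}" if "v \<in> V" for v
    using assms that finite_out_arcs[of v]
    by (metis card_0_eq out_degree_def variable_regular_def)
  have "arcs G = {}"
  proof (rule ccontr)
    assume "arcs G \<noteq> {}"
    then obtain e where e: "e \<in> arcs G" by blast
    then obtain e' where "e' \<in> arcs G" "tail G e' = head G e"
      using sym_arcs by (auto simp: symmetric_conv)
    then show False using bipartite[OF e] no_out e by (auto simp: set_eq_iff)
  qed
  then have "\<not> cycle p" for p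
    by (cases p) (auto simp: cycle_def awalk_def)
  then show ?thesis by (simp add: girth_def top_enat_def)
qed

theorem theorem7:
  fixes G :: "('n, 'e) pre_digraph" and V C :: "'n set" and k \<gamma> :: nat
  assumes "k \<ge> 1"
    and "tanner_graph G V C"
    and "variable_regular G V \<gamma>"
    and "girth G = enat (2 * (2 * k + 1))"
  shows "\<not> (\<exists>a b S. elementary_trapping_set G V C a b S \<and>
           real b / real a < 1 \<and> real a \<le> (real \<gamma> - 2) ^ k)"
proof
  assume "\<exists>a b S. elementary_trapping_set G V C a b S \<and>
           real b / real a < 1 \<and> real a \<le> (real \<gamma> - 2) ^ k"
  then obtain a b S where ets: "elementary_trapping_set G V C a b S"
    and ba: "real b / real a < 1" and a: "real a \<le> (real \<gamma> - 2) ^ k" by blast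
  interpret tanner_graph G V C by fact
  let ?A = "\<lambda>u v. u \<rightarrow>\<^bsub>G\<^esub> v"
  let ?R = "sharing_neighbour ?A S"
  have girth6: "6 \<le> girth G"
    using assms(1,4) by (simp add: numeral_eq_enat)
  note pairs = ets_variable_pairs[OF assms(3) ets girth6]
  have S: "S \<subseteq> V" "S \<noteq> {}" "card S = a"
    using ets by (auto simp: elementary_trapping_set_def trapping_set_def)
  have finS: "finite S" using S(1) verts_eq finite_subset[OF _ finite_verts] by blast
  then have a1: "a \<ge> 1" using S by (auto simp: Suc_le_eq card_gt_0_iff)
  then have "b < a" using ba by simp
  consider "\<gamma> = 0" | "\<gamma> = 1" | "\<gamma> = 2" | "\<gamma> \<ge> 3" by linarith
  then show False
  proof cases
    case 1
    then show False using girth_variable_regular_0 assms(3,4) by simp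
  next
    case 2
    \<comment> \<open>Here the size bound is \<open>(-1) ^ k\<close>, at most 1. A single variable
      has no neighbour in \<open>H\<close>, which then forces \<open>1 <= b\<close>.\<close>
    then have "a = 1"
      using a a1 by (cases "even k") auto
    then obtain v where "S = {v}" using S(3) card_1_singletonE by auto
    then have "(\<Sum>v\<in>S. card {w \<in> S. ?R v w}) = 0"
      by (intro sum.neutral) (auto simp: sharing_neighbour_def)
    then show False using pairs(1) \<open>b < a\<close> 2 \<open>a = 1\<close> by simp
  next
    case 3
    then show False using a a1 assms(1) by (simp add: power_0_left)
  next
    case 4
    have symA: "symp ?A" using sym_arcs by (auto intro!: sympI dest: arcs_ends_symmetric)
    have "(real \<gamma> - 1 - 1) ^ k < real (card S)"
    proof (rule irregular_moore_bound[of S ?R])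
      show "symp ?R"
        using symA by (auto simp: symp_def sharing_neighbour_def)
      show "hd xs \<noteq> last xs"
        if xs: "nb_walk ?R xs" "2 \<le> length xs" "length xs \<le> 2 * k + 1" for xs
      proof -
        obtain x xs' where eq: "xs = x # xs'" using xs(2) by (cases xs) auto
        obtain ys where ys: "nb_walk ?A (x # ys)" "length ys = 2 * length xs'"
          "last (x # ys) = last (x # xs')"
          by (rule nb_walk_subdivide[OF symA xs(1)[unfolded eq]]) (use pairs(2) in blast)
        \<comment> \<open>Subdividing at most \<open>2 * k\<close> steps gives at most
          \<open>4 * k + 1\<close> vertices, below the girth \<open>4 * k + 2\<close>.\<close>
        have "distinct (x # ys)"
          using ys xs(3) assms(4) by (intro nb_walk_distinct) (auto simp: eq)
        moreover have "ys \<noteq> []" using ys(2) xs(2) eq by auto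
        ultimately have "last ys \<noteq> x" by (auto dest: last_in_set)
        then show ?thesis using ys(3) \<open>ys \<noteq> []\<close> xs(2) by (auto simp: eq)
      qed
      have "real a * real \<gamma> \<le> real b + (\<Sum>v\<in>S. real (card {w \<in> S. ?R v w}))"
        using pairs(1) by (simp flip: of_nat_mult of_nat_sum of_nat_add)
      then show "(real \<gamma> - 1) * real (card S) < (\<Sum>v\<in>S. real (card {w \<in> S. ?R v w}))"
        using \<open>b < a\<close> S(3) by (simp add: algebra_simps)
    qed (use finS assms(1) 4 in auto)
    then show False using a S(3) by simp
  qed
qed

end
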